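(* Assume $\mathsf{MA}(\sigma\text{-centered})$. Then every eventually different family $\mathcal E_0\subseteq\omega^\omega$ of size $<2^{\aleph_0}$ is contained in a tight eventually different family. In particular, $\mathsf{CH}$ implies that tight eventually different families exist.
   Context: For $f,g\in\omega^\omega$, $f\neq^* g$ means there is $k<\omega$ with $f(n)\neq g(n)$ for all $n>k$. A set $\mathcal E\subseteq\omega^\omega$ is an eventually different family if $f\neq^* g$ for all distinct $f,g\in\mathcal E$. A tree is a set $T\subseteq\omega^{<\omega}$ closed under initial segments and pruned (every $t\in T$ has a proper extension in $T$). Functions and finite sequences are identified with their graphs (subsets of $\omega\times\omega$); for $t\in T$ let $T_t=\{s\in T: s\subseteq t\text{ or }t\subseteq s\}$. $\mathcal I_T(\mathcal E)^+$ is the set of trees $T$ such that for no $t\in T$ and no finite $X\subseteq\mathcal E$ is $\bigcup T_t\setminus\bigcup X$ finite. A function $g\in\omega^\omega$ densely diagonalizes a tree $T$ if for every $t\in T$ there are $s\in T$ with $s\supsetneq t$ and $k\in\mathrm{dom}(s)\setminus\mathrm{dom}(t)$ with $s(k)=g(k)$. $\mathcal E$ is tight if for every countable family $\{T_n:n<\omega\}\subseteq\mathcal I_T(\mathcal E)^+$ there is a single $g\in\mathcal E$ densely diagonalizing every $T_n$. *)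

theory Defs
  imports Main "HOL-Library.Sublist"
begin

unbundle cardinal_syntax

section \<open>Eventually different families and trees\<close>

definition ev_neq :: "(nat \<Rightarrow> nat) \<Rightarrow> (nat \<Rightarrow> nat) \<Rightarrow> bool" (infix "\<noteq>\<^sup>*" 50) where
  "f \<noteq>\<^sup>* g \<longleftrightarrow> (\<exists>k. \<forall>n>k. f n \<noteq> g n)"

definition ev_different_family :: "(nat \<Rightarrow> nat) set \<Rightarrow> bool" where
  "ev_different_family \<E> \<longleftrightarrow> (\<forall>f\<in>\<E>. \<forall>g\<in>\<E>. f \<noteq> g \<longrightarrow> f \<noteq>\<^sup>* g)"

text \<open>
  A finite sequence \<open>s\<close> is a list, with domain \<open>{..<length s}\<close>; initial segments are prefixes.
  As in the usual definition via closure and pruning, the empty set counts as a tree.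
\<close>

definition is_tree :: "nat list set \<Rightarrow> bool" where
  "is_tree T \<longleftrightarrow>
     (\<forall>t\<in>T. \<forall>s. prefix s t \<longrightarrow> s \<in> T) \<and>
     (\<forall>t\<in>T. \<exists>s\<in>T. strict_prefix t s)"

definition subtree_at :: "nat list set \<Rightarrow> nat list \<Rightarrow> nat list set" where
  "subtree_at T t = {s \<in> T. prefix s t \<or> prefix t s}"

definition seq_dom :: "nat list \<Rightarrow> nat set" where
  "seq_dom s = {..<length s}"

definition seq_graph :: "nat list \<Rightarrow> (nat \<times> nat) set" where
  "seq_graph s = {(i, s ! i) | i. i \<in> seq_dom s}"

definition fun_graph :: "(nat \<Rightarrow> nat) \<Rightarrow> (nat \<times> nat) set" where
  "fun_graph f = {(i, f i) | i. True}"

text \<open>The collection \<open>\<I>\<^sub>T(\<E>)\<^sup>+\<close>.\<close>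

definition positive_trees :: "(nat \<Rightarrow> nat) set \<Rightarrow> nat list set set" where
  "positive_trees \<E> =
     {T. is_tree T \<and>
         \<not> (\<exists>t\<in>T. \<exists>X. finite X \<and> X \<subseteq> \<E> \<and>
              finite ((\<Union>s\<in>subtree_at T t. seq_graph s) - (\<Union>f\<in>X. fun_graph f)))}"

definition densely_diagonalizes :: "(nat \<Rightarrow> nat) \<Rightarrow> nat list set \<Rightarrow> bool" where
  "densely_diagonalizes g T \<longleftrightarrow>
     (\<forall>t\<in>T. \<exists>s\<in>T. strict_prefix t s \<and> (\<exists>k \<in> seq_dom s - seq_dom t. s ! k = g k))"

definition tight :: "(nat \<Rightarrow> nat) set \<Rightarrow> bool" where
  "tight \<E> \<longleftrightarrow>
     (\<forall>T :: nat \<Rightarrow> nat list set. (\<forall>n. T n \<in> positive_trees \<E>) \<longrightarrow>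
        (\<exists>g\<in>\<E>. \<forall>n. densely_diagonalizes g (T n)))"


section \<open>The continuum, CH and Martin's axiom for \<open>\<sigma>\<close>-centered posets\<close>

text \<open>\<open>natLeq\<close> is the cardinal \<open>\<aleph>\<^sub>0\<close>, so this is \<open>2\<close> to the power \<open>\<aleph>\<^sub>0\<close>.\<close>

abbreviation continuum :: "(nat \<Rightarrow> bool) rel" where
  "continuum \<equiv> ctwo ^c natLeq"

definition CH :: bool where
  "CH \<longleftrightarrow> continuum =o cardSuc natLeq"

text \<open>
  In the following, \<open>r\<close> is a partial order on \<open>P\<close> and \<open>(p, q) \<in> r\<close> means \<open>p \<le> q\<close>, that is, \<open>p\<close> is
  the stronger condition.
\<close>

definition dense_in :: "'p set \<Rightarrow> 'p rel \<Rightarrow> 'p set \<Rightarrow> bool" where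
  "dense_in P r D \<longleftrightarrow> D \<subseteq> P \<and> (\<forall>p\<in>P. \<exists>d\<in>D. (d, p) \<in> r)"

definition filter_in :: "'p set \<Rightarrow> 'p rel \<Rightarrow> 'p set \<Rightarrow> bool" where
  "filter_in P r G \<longleftrightarrow> G \<subseteq> P \<and> G \<noteq> {} \<and>
     (\<forall>p\<in>G. \<forall>q\<in>P. (p, q) \<in> r \<longrightarrow> q \<in> G) \<and>
     (\<forall>p\<in>G. \<forall>q\<in>G. \<exists>u\<in>G. (u, p) \<in> r \<and> (u, q) \<in> r)"

definition centered_in :: "'p set \<Rightarrow> 'p rel \<Rightarrow> 'p set \<Rightarrow> bool" where
  "centered_in P r C \<longleftrightarrow> C \<subseteq> P \<and>
     (\<forall>F. finite F \<and> F \<subseteq> C \<longrightarrow> (\<exists>u\<in>P. \<forall>p\<in>F. (u, p) \<in> r))"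

definition sigma_centered :: "'p set \<Rightarrow> 'p rel \<Rightarrow> bool" where
  "sigma_centered P r \<longleftrightarrow>
     (\<exists>C :: nat \<Rightarrow> 'p set. (\<forall>n. centered_in P r (C n)) \<and> P = (\<Union>n. C n))"

definition MA_for :: "'p set \<Rightarrow> 'p rel \<Rightarrow> bool" where
  "MA_for P r \<longleftrightarrow>
     (\<forall>\<D> :: 'p set set. |\<D>| <o continuum \<and> (\<forall>D\<in>\<D>. dense_in P r D) \<longrightarrow>
        (\<exists>G. filter_in P r G \<and> (\<forall>D\<in>\<D>. G \<inter> D \<noteq> {})))"

text \<open>
  HOL cannot quantify over types inside a formula, so the axiom ranges over the posets whose carrier
  is a set of sets of natural numbers. Up to isomorphism these are all posets of size at most the
  continuum. This loses nothing: by the usual Loewenheim-Skolem argument, Martin's axiom for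
  \<open>\<sigma>\<close>-centered posets of size less than the continuum already implies it for all \<open>\<sigma>\<close>-centered posets.
  As a hypothesis, the version below is formally the weaker one.
\<close>

definition MA_sigma_centered :: bool where
  "MA_sigma_centered \<longleftrightarrow>
     (\<forall>(P :: nat set set) r.
        P \<noteq> {} \<and> partial_order_on P r \<and> sigma_centered P r \<longrightarrow> MA_for P r)"

end

theory Submission
  imports Defs "HOL-Library.Countable_Set_Type"
begin

text \<open>
  Given fewer than continuum many functions \<open>\<A>\<close> and countably many positive trees, force with pairs
  \<open>(s, F)\<close>, where \<open>s\<close> is a finite approximation of the new function \<open>g\<close> and \<open>F \<subseteq> \<A>\<close> is a finite set
  of functions that \<open>g\<close> promises to avoid beyond \<open>s\<close>. Conditions with the same \<open>s\<close> are compatible,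
  so the poset is \<open>\<sigma>\<close>-centered. Positivity of a tree \<open>T\<close> provides, beyond any \<open>t \<in> T\<close>, a position and
  a value in \<open>T\<close> that no function in \<open>F\<close> takes there; this makes diagonalization dense.
  A transfinite recursion along a well-order of all sequences of trees then builds the tight family:
  positivity passes to smaller families, so a sequence that is positive for the whole family was
  positive when its turn came. Under \<open>CH\<close>, fewer than continuum many dense sets are countably many,
  so the Rasiowa--Sikorski lemma provides the axiom.
\<close>

section \<open>Cardinality\<close>

lemma continuum_eq: "continuum = |UNIV :: (nat \<Rightarrow> bool) set|"
  by (simp add: cexp_def ctwo_def Field_card_of Field_natLeq Func_def)

lemma infinite_nat_predicates: "infinite (UNIV :: (nat \<Rightarrow> bool) set)"
proof
  assume "finite (UNIV :: (nat \<Rightarrow> bool) set)"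
  then have "finite (range (\<lambda>n::nat. \<lambda>m. m = n))"
    by (rule finite_subset[rotated]) simp
  moreover have "inj (\<lambda>n::nat. \<lambda>m. m = n)"
    by (rule injI) (metis)
  ultimately show False
    using finite_imageD infinite_UNIV_nat by blast
qed

lemma countable_ordLess_continuum:
  assumes "countable A"
  shows "|A| <o continuum"
proof -
  have "|A| \<le>o |UNIV :: nat set|"
    using assms by (simp add: countable_card_of_nat)
  moreover have "|UNIV :: nat set| <o |Pow (UNIV :: nat set)|"
    by (rule card_of_Pow)
  moreover have "|Pow (UNIV :: nat set)| \<le>o |UNIV :: (nat \<Rightarrow> bool) set|"
    by (rule card_of_ordLeqI[where f = "\<lambda>S n. n \<in> S"]) (auto simp: inj_on_def fun_eq_iff)
  ultimately show ?thesis
    unfolding continuum_eq using ordLeq_ordLess_trans ordLess_ordLeq_trans by blast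
qed

lemma Un_ordLess_continuum:
  assumes "|A| <o continuum" "|B| <o continuum"
  shows "|A \<union> B| <o continuum"
  using card_of_Un_ordLess_infinite[OF infinite_nat_predicates] assms by (simp add: continuum_eq)

lemma image_ordLess_continuum:
  assumes "|A| <o continuum"
  shows "|f ` A| <o continuum"
  using assms card_of_image ordLeq_ordLess_trans by blast

text \<open>A sequence of trees is coded by the set of pairs of an index and a node, which lives on
  a countable set. This bounds the length of the later recursion.\<close>

lemma tree_sequences_ordLeq_continuum: "|UNIV :: (nat \<Rightarrow> nat list set) set| \<le>o continuum"
  unfolding continuum_eq
proof (rule card_of_ordLeqI)
  show "inj (\<lambda>S m. snd (from_nat m :: nat \<times> nat list) \<in> S (fst (from_nat m :: nat \<times> nat list)))"
  proof (rule injI)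
    fix S S' :: "nat \<Rightarrow> nat list set"
    assume eq: "(\<lambda>m. snd (from_nat m :: nat \<times> nat list) \<in> S (fst (from_nat m :: nat \<times> nat list)))
      = (\<lambda>m. snd (from_nat m :: nat \<times> nat list) \<in> S' (fst (from_nat m :: nat \<times> nat list)))"
    have "t \<in> S n \<longleftrightarrow> t \<in> S' n" for n t
      using fun_cong[OF eq, of "to_nat (n, t)"] by simp
    then show "S = S'" by blast
  qed
qed simp

section \<open>Martin's axiom\<close>

text \<open>The axiom is stated for sets of sets of naturals, while the forcing conditions have
  another type. Copying the order along \<open>e\<close> preserves density and centeredness, and the
  filter obtained on the image is pulled back.\<close>

lemma MA_for_transfer:
  fixes P :: "'p set" and e :: "'p \<Rightarrow> nat set"
  assumes MA: MA_sigma_centered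
    and inj: "inj_on e P" and ne: "P \<noteq> {}"
    and po: "partial_order_on P r" and sc: "sigma_centered P r"
  shows "MA_for P r"
proof -
  define r' where "r' = (\<lambda>(p, q). (e p, e q)) ` r"
  have rP: "r \<subseteq> P \<times> P"
    using po by (simp add: partial_order_on_def preorder_on_def)
  have r'_iff: "(e p, e q) \<in> r' \<longleftrightarrow> (p, q) \<in> r" if "p \<in> P" "q \<in> P" for p q
  proof
    assume "(e p, e q) \<in> r'"
    then obtain a b where "(a, b) \<in> r" "e p = e a" "e q = e b"
      unfolding r'_def by auto
    moreover from this have "p = a" "q = b"
      using inj_onD[OF inj] that rP by blast+
    ultimately show "(p, q) \<in> r" by simp
  qed (force simp: r'_def)
  have "partial_order_on (e ` P) r'"
    unfolding partial_order_on_def preorder_on_def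
  proof (intro conjI)
    show r'P: "r' \<subseteq> e ` P \<times> e ` P"
      using rP unfolding r'_def by auto
    show "refl_on (e ` P) r'"
      using po by (auto simp: refl_on_def r'_iff partial_order_on_def preorder_on_def)
    show "trans r'"
    proof (rule transI)
      fix x y z assume xyz: "(x, y) \<in> r'" "(y, z) \<in> r'"
      then obtain a b c where "x = e a" "y = e b" "z = e c" "a \<in> P" "b \<in> P" "c \<in> P"
        using r'P by blast
      moreover have "trans r"
        using po by (simp add: partial_order_on_def preorder_on_def)
      ultimately show "(x, z) \<in> r'"
        using xyz r'_iff by (metis transD)
    qed
    show "antisym r'"
    proof (rule antisymI)
      fix x y assume xy: "(x, y) \<in> r'" "(y, x) \<in> r'"
      then obtain a b where "x = e a" "y = e b" "a \<in> P" "b \<in> P"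
        using r'P by blast
      moreover have "antisym r"
        using po by (simp add: partial_order_on_def)
      ultimately show "x = y"
        using xy r'_iff by (metis antisymD)
    qed
  qed
  moreover have "sigma_centered (e ` P) r'"
  proof -
    obtain C where C: "\<And>n::nat. centered_in P r (C n)" and PC: "P = (\<Union>n. C n)"
      using sc unfolding sigma_centered_def by blast
    have "centered_in (e ` P) r' (e ` C n)" for n
      unfolding centered_in_def
    proof (intro conjI allI impI)
      have CP: "C n \<subseteq> P"
        using PC by blast
      then show "e ` C n \<subseteq> e ` P"
        by blast
      fix F assume "finite F \<and> F \<subseteq> e ` C n"
      then obtain F' where F': "F' \<subseteq> C n" "finite F'" "F = e ` F'"
        by (meson finite_subset_image)
      then obtain u where "u \<in> P" "\<forall>p\<in>F'. (u, p) \<in> r"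
        using C[of n] unfolding centered_in_def by blast
      then show "\<exists>u\<in>e ` P. \<forall>p\<in>F. (u, p) \<in> r'"
        using F' CP r'_iff by blast
    qed
    moreover have "e ` P = (\<Union>n. e ` C n)"
      using PC by blast
    ultimately show ?thesis
      unfolding sigma_centered_def by (intro exI[of _ "\<lambda>n. e ` C n"] conjI allI)
  qed
  ultimately have MA': "MA_for (e ` P) r'"
    using MA[unfolded MA_sigma_centered_def, rule_format, of "e ` P" r'] ne by simp
  show ?thesis
    unfolding MA_for_def
  proof (intro allI impI, elim conjE)
    fix \<D> :: "'p set set"
    assume small: "|\<D>| <o continuum" and dense: "\<forall>D\<in>\<D>. dense_in P r D"
    have "dense_in (e ` P) r' (e ` D)" if "D \<in> \<D>" for D
      unfolding dense_in_def
    proof (intro conjI ballI)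
      have D: "D \<subseteq> P" "\<forall>p\<in>P. \<exists>d\<in>D. (d, p) \<in> r"
        using dense that unfolding dense_in_def by auto
      then show "e ` D \<subseteq> e ` P"
        by blast
      fix x assume "x \<in> e ` P"
      then obtain p where p: "p \<in> P" "x = e p"
        by blast
      then obtain d where "d \<in> D" "(d, p) \<in> r"
        using D(2) by blast
      then show "\<exists>d\<in>e ` D. (d, x) \<in> r'"
        using p D(1) r'_iff by blast
    qed
    moreover have "|(`) e ` \<D>| <o continuum"
      using small by (rule image_ordLess_continuum)
    ultimately obtain G' where G': "filter_in (e ` P) r' G'" "\<And>D. D \<in> \<D> \<Longrightarrow> G' \<inter> e ` D \<noteq> {}"
      using MA'[unfolded MA_for_def, rule_format, of "(`) e ` \<D>"] by auto
    define G where "G = {p \<in> P. e p \<in> G'}"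
    have G'_eq: "G' = e ` G"
      using G'(1) unfolding filter_in_def G_def by blast
    have "filter_in P r G"
      unfolding filter_in_def
    proof (intro conjI ballI impI)
      show "G \<subseteq> P" "G \<noteq> {}"
        using G'(1) G'_eq unfolding G_def filter_in_def by auto
    next
      fix p q assume "p \<in> G" "q \<in> P" "(p, q) \<in> r"
      then show "q \<in> G"
        using G'(1) r'_iff unfolding filter_in_def G_def by blast
    next
      fix p q assume pq: "p \<in> G" "q \<in> G"
      then have "\<exists>v\<in>G'. (v, e p) \<in> r' \<and> (v, e q) \<in> r'"
        using G'(1) unfolding filter_in_def G_def by simp
      then obtain u where "u \<in> G" "(e u, e p) \<in> r'" "(e u, e q) \<in> r'"
        unfolding G'_eq by blast
      then show "\<exists>u\<in>G. (u, p) \<in> r \<and> (u, q) \<in> r"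
        using pq r'_iff unfolding G_def by blast
    qed
    moreover have "G \<inter> D \<noteq> {}" if D: "D \<in> \<D>" for D
    proof -
      obtain d where "d \<in> D" "e d \<in> G'"
        using G'(2)[OF D] by blast
      moreover from this have "d \<in> P"
        using dense D \<open>d \<in> D\<close> unfolding dense_in_def by blast
      ultimately show ?thesis
        unfolding G_def by blast
    qed
    ultimately show "\<exists>G. filter_in P r G \<and> (\<forall>D\<in>\<D>. G \<inter> D \<noteq> {})"
      by blast
  qed
qed

section \<open>Countably many dense sets, and CH\<close>

lemma Rasiowa_Sikorski:
  assumes po: "partial_order_on P r" and ne: "P \<noteq> {}"
    and cnt: "countable \<D>" and dense: "\<forall>D\<in>\<D>. dense_in P r D"
  shows "\<exists>G. filter_in P r G \<and> (\<forall>D\<in>\<D>. G \<inter> D \<noteq> {})"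
proof -
  have refl: "(p, p) \<in> r" if "p \<in> P" for p
    using po that by (auto simp: partial_order_on_def preorder_on_def refl_on_def)
  have tr: "trans r"
    using po by (simp add: partial_order_on_def preorder_on_def)
  \<comment> \<open>Inserting \<open>P\<close>, which is dense in itself, makes the enumerated
    family nonempty even when \<open>\<D>\<close> is empty.\<close>
  define D where "D = from_nat_into (insert P \<D>)"
  have "dense_in P r P"
    using refl unfolding dense_in_def by blast
  then have dense_D: "dense_in P r (D n)" for n
    using from_nat_into[of "insert P \<D>" n] dense unfolding D_def by auto
  have range_D: "range D = insert P \<D>"
    unfolding D_def using cnt by (intro range_from_nat_into) auto
  have "\<exists>p. \<forall>n. p n \<in> P \<and> (p (Suc n), p n) \<in> r \<and> p (Suc n) \<in> D n"
  proof (rule dependent_nat_choice)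
    show "\<exists>x. x \<in> P" using ne by blast
  next
    fix x n assume "x \<in> P"
    then show "\<exists>y. y \<in> P \<and> (y, x) \<in> r \<and> y \<in> D n"
      using dense_D[of n] unfolding dense_in_def by blast
  qed
  then obtain p where p: "\<And>n. p n \<in> P" "\<And>n. (p (Suc n), p n) \<in> r" "\<And>n. p (Suc n) \<in> D n"
    by blast
  have mono: "(p (n + k), p n) \<in> r" for n k
  proof (induction k)
    case 0
    show ?case using refl p(1) by simp
  next
    case (Suc k)
    then show ?case using p(2)[of "n + k"] tr by (auto dest: transD)
  qed
  \<comment> \<open>The upward closure of a descending sequence that enters every
    \<open>D n\<close>.\<close>
  define G where "G = {q \<in> P. \<exists>n. (p n, q) \<in> r}"
  have pG: "p n \<in> G" for n
    using p(1) refl unfolding G_def by blast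
  have "filter_in P r G"
    unfolding filter_in_def
  proof (intro conjI ballI impI)
    show "G \<subseteq> P" unfolding G_def by blast
    show "G \<noteq> {}" using pG by blast
  next
    fix a b assume "a \<in> G" "b \<in> P" "(a, b) \<in> r"
    then show "b \<in> G"
      using tr unfolding G_def by (blast dest: transD)
  next
    fix a b assume "a \<in> G" "b \<in> G"
    then obtain n m where nm: "(p n, a) \<in> r" "(p m, b) \<in> r"
      unfolding G_def by blast
    have "(p (n + m), a) \<in> r" "(p (n + m), b) \<in> r"
      using nm mono[of n m] mono[of m n] tr by (auto simp: add.commute dest: transD)
    then show "\<exists>u\<in>G. (u, a) \<in> r \<and> (u, b) \<in> r"
      using pG by blast
  qed
  moreover have "G \<inter> X \<noteq> {}" if X: "X \<in> \<D>" for X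
  proof -
    obtain n where "X = D n"
      using range_D X by blast
    then show ?thesis
      using p(3)[of n] pG by blast
  qed
  ultimately show ?thesis by blast
qed

lemma CH_imp_MA_sigma_centered:
  assumes CH
  shows MA_sigma_centered
  unfolding MA_sigma_centered_def MA_for_def
proof (intro allI impI, elim conjE)
  fix P r and \<D> :: "nat set set set"
  assume P: "P \<noteq> {}" "partial_order_on P r"
    and small: "|\<D>| <o continuum" and dense: "\<forall>D\<in>\<D>. dense_in P r D"
  have "|\<D>| <o cardSuc natLeq"
    using small assms ordLess_ordIso_trans unfolding CH_def by blast
  then have "|\<D>| \<le>o natLeq"
    using cardSuc_ordLeq_ordLess[OF natLeq_Card_order card_of_Card_order] by blast
  then have "countable \<D>"
    using card_of_nat ordIso_symmetric ordLeq_ordIso_trans countable_card_of_nat by blast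
  then show "\<exists>G. filter_in P r G \<and> (\<forall>D\<in>\<D>. G \<inter> D \<noteq> {})"
    using Rasiowa_Sikorski P dense by blast
qed

section \<open>Forcing a diagonalizing function\<close>

definition conditions :: "(nat \<Rightarrow> nat) set \<Rightarrow> (nat list \<times> (nat \<Rightarrow> nat) set) set" where
  "conditions \<A> = {(s, F). finite F \<and> F \<subseteq> \<A>}"

definition avoids :: "nat list \<Rightarrow> nat \<Rightarrow> (nat \<Rightarrow> nat) set \<Rightarrow> bool" where
  "avoids s n F \<longleftrightarrow> (\<forall>f\<in>F. \<forall>k. n \<le> k \<and> k < length s \<longrightarrow> s ! k \<noteq> f k)"

text \<open>Promises bind only the entries added after they are made. A condition therefore puts no
  relation between \<open>s\<close> and \<open>F\<close>, and any member of \<open>\<A>\<close> can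
  be added to \<open>F\<close> at once.\<close>

definition cond_le :: "(nat \<Rightarrow> nat) set \<Rightarrow> (nat list \<times> (nat \<Rightarrow> nat) set) rel" where
  "cond_le \<A> = {((s', F'), (s, F)). (s', F') \<in> conditions \<A> \<and> (s, F) \<in> conditions \<A> \<and>
     prefix s s' \<and> F \<subseteq> F' \<and> avoids s' (length s) F}"

lemma prefix_nth: "prefix s t \<Longrightarrow> k < length s \<Longrightarrow> t ! k = s ! k"
  by (auto simp: prefix_def nth_append)

text \<open>A position below \<open>length s'\<close> carries the same entry in \<open>s'\<close>
  and \<open>s''\<close>, so the first avoidance covers it; later positions fall under the
  second.\<close>

lemma avoids_trans:
  assumes "prefix s s'" "prefix s' s''" "avoids s' (length s) F" "avoids s'' (length s') F"
  shows "avoids s'' (length s) F"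
  using assms prefix_nth unfolding avoids_def by (metis not_le)

lemma avoids_mono: "avoids s n F \<Longrightarrow> F' \<subseteq> F \<Longrightarrow> avoids s n F'"
  by (auto simp: avoids_def)

lemma partial_order_cond_le: "partial_order_on (conditions \<A>) (cond_le \<A>)"
  unfolding partial_order_on_def preorder_on_def
proof (intro conjI)
  show "cond_le \<A> \<subseteq> conditions \<A> \<times> conditions \<A>"
    unfolding cond_le_def by auto
  show "refl_on (conditions \<A>) (cond_le \<A>)"
    unfolding refl_on_def cond_le_def avoids_def by auto
  show "trans (cond_le \<A>)"
    unfolding cond_le_def
    by (rule transI) (auto intro: prefix_order.trans avoids_trans avoids_mono)
  show "antisym (cond_le \<A>)"
    unfolding cond_le_def by (rule antisymI) auto
qed

lemma sigma_centered_conditions: "sigma_centered (conditions \<A>) (cond_le \<A>)"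
proof -
  define C where "C n = {(s, F). s = (from_nat n :: nat list) \<and> finite F \<and> F \<subseteq> \<A>}" for n
  have "centered_in (conditions \<A>) (cond_le \<A>) (C n)" for n
    unfolding centered_in_def
  proof (intro conjI allI impI)
    show "C n \<subseteq> conditions \<A>"
      unfolding C_def conditions_def by auto
    fix K assume K: "finite K \<and> K \<subseteq> C n"
    \<comment> \<open>All members of \<open>K\<close> share one stem. Keeping it and uniting the
      promises adds no entries, so nothing has to be avoided.\<close>
    let ?u = "(from_nat n :: nat list, \<Union>(snd ` K))"
    have K_C: "fst p = from_nat n \<and> finite (snd p) \<and> snd p \<subseteq> \<A>" if "p \<in> K" for p
      using subsetD[OF conjunct2[OF K] that] unfolding C_def by auto
    then have u: "?u \<in> conditions \<A>"
      using K unfolding conditions_def by blast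
    have "(?u, p) \<in> cond_le \<A>" if "p \<in> K" for p
    proof -
      note p_K = that
      obtain F where p: "p = (from_nat n, F)" "(from_nat n, F) \<in> conditions \<A>"
        using K_C[OF p_K] unfolding conditions_def by (cases p) auto
      moreover have "F \<subseteq> \<Union>(snd ` K)"
        using p(1) p_K by force
      ultimately show ?thesis
        using u unfolding cond_le_def avoids_def by auto
    qed
    with u show "\<exists>u\<in>conditions \<A>. \<forall>p\<in>K. (u, p) \<in> cond_le \<A>"
      by blast
  qed
  moreover have "conditions \<A> = (\<Union>n. C n)"
  proof
    show "conditions \<A> \<subseteq> (\<Union>n. C n)"
    proof
      fix p assume "p \<in> conditions \<A>"
      then have "p \<in> C (to_nat (fst p))"
        unfolding conditions_def C_def by auto
      then show "p \<in> (\<Union>n. C n)" by blast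
    qed
  qed (auto simp: conditions_def C_def)
  ultimately show ?thesis
    unfolding sigma_centered_def by blast
qed

text \<open>
  A finite set of functions is determined by the tree of their finite restrictions: each branch of
  that tree agrees infinitely often with one member of the set, hence equals it.
\<close>

definition encode_condition :: "nat list \<times> (nat \<Rightarrow> nat) set \<Rightarrow> nat set" where
  "encode_condition = (\<lambda>(s, F).
     insert (to_nat (Inl s :: nat list + nat list))
       {to_nat (Inr (map f [0..<n]) :: nat list + nat list) | f n. f \<in> F})"

text \<open>If \<open>h\<close> differed from every member of \<open>F\<close>, finiteness would
  give one bound \<open>N\<close> below which all these disagreements occur, and the restriction of
  \<open>h\<close> to \<open>N\<close> would match no member.\<close>

lemma restrictions_determine:
  assumes "finite F" and restr: "\<And>n::nat. \<exists>f\<in>F. map h [0..<n] = map f [0..<n]"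
  shows "(h :: nat \<Rightarrow> nat) \<in> F"
proof (rule ccontr)
  assume "h \<notin> F"
  then have "\<forall>f\<in>F. \<exists>k. f k \<noteq> h k"
    by (metis ext)
  then obtain k where k: "\<And>f. f \<in> F \<Longrightarrow> f (k f) \<noteq> h (k f)"
    by metis
  obtain N where N: "\<And>f. f \<in> F \<Longrightarrow> k f < N"
    using finite_nat_set_iff_bounded[of "k ` F"] \<open>finite F\<close> by auto
  obtain f where "f \<in> F" "map h [0..<N] = map f [0..<N]"
    using restr by blast
  then have "h (k f) = f (k f)"
    using N[of f] by simp
  then show False
    using k[of f] \<open>f \<in> F\<close> by simp
qed

lemma inj_encode_condition: "inj_on encode_condition (conditions \<A>)"
proof (rule inj_onI, clarify)
  fix s F s' F'
  assume fin: "(s, F) \<in> conditions \<A>" "(s', F') \<in> conditions \<A>"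
    and eq: "encode_condition (s, F) = encode_condition (s', F')"
  have s_iff: "to_nat (Inl t :: nat list + nat list) \<in> encode_condition (u, H) \<longleftrightarrow> t = u" for t u H
    unfolding encode_condition_def by auto
  have F_iff: "to_nat (Inr t :: nat list + nat list) \<in> encode_condition (u, H)
      \<longleftrightarrow> (\<exists>f\<in>H. \<exists>n. t = map f [0..<n])" for t u H
    unfolding encode_condition_def by auto
  \<comment> \<open>Stated for arbitrary pairs so that it yields both inclusions between
    \<open>F\<close> and \<open>F'\<close>.\<close>
  have sub: "H \<subseteq> H'" if "finite H'" "encode_condition (u, H) = encode_condition (u', H')" for u H u' H'
  proof
    fix h assume "h \<in> H"
    show "h \<in> H'"
    proof (rule restrictions_determine[OF \<open>finite H'\<close>])
      fix n
      have "to_nat (Inr (map h [0..<n]) :: nat list + nat list) \<in> encode_condition (u', H')"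
        using F_iff that(2) \<open>h \<in> H\<close> by blast
      then obtain f m where f: "f \<in> H'" "map h [0..<n] = map f [0..<m]"
        unfolding F_iff by blast
      moreover from f have "n = m"
        by (metis diff_zero length_map length_upt)
      ultimately show "\<exists>f\<in>H'. map h [0..<n] = map f [0..<n]"
        by blast
    qed
  qed
  show "s = s' \<and> F = F'"
  proof
    show "s = s'"
      using s_iff[of s s F] s_iff[of s s' F'] eq by simp
    have "finite F" "finite F'"
      using fin unfolding conditions_def by auto
    then show "F = F'"
      using sub[OF _ eq] sub[OF _ eq[symmetric]] by blast
  qed
qed

section \<open>Extending conditions, and the dense sets\<close>

lemma extend_avoiding:
  assumes "finite F" "length s \<le> n"
  shows "\<exists>s'. prefix s s' \<and> length s' = n \<and> avoids s' (length s) F"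
  using assms(2)
proof (induction n rule: dec_induct)
  case base
  show ?case by (rule exI[of _ s]) (auto simp: avoids_def)
next
  case (step n)
  then obtain s' where s': "prefix s s'" "length s' = n" "avoids s' (length s) F"
    by blast
  obtain v where v: "v \<notin> (\<lambda>f. f n) ` F"
    using ex_new_if_finite[OF infinite_UNIV_nat, of "(\<lambda>f. f n) ` F"] assms(1) by blast
  show ?case
  proof (intro exI[of _ "s' @ [v]"] conjI)
    show "prefix s (s' @ [v])" "length (s' @ [v]) = Suc n"
      using s' by auto
    show "avoids (s' @ [v]) (length s) F"
      using s' v by (auto simp: avoids_def nth_append less_Suc_eq)
  qed
qed

lemma tree_extension_of_length:
  assumes "is_tree T" "t \<in> T"
  shows "\<exists>t'\<in>T. prefix t t' \<and> n \<le> length t'"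
proof (induction n)
  case 0
  show ?case using assms by auto
next
  case (Suc n)
  then obtain t' where t': "t' \<in> T" "prefix t t'" "n \<le> length t'"
    by blast
  obtain u where "u \<in> T" "strict_prefix t' u"
    using assms(1) t'(1) unfolding is_tree_def by blast
  then show ?case
    using t' prefix_length_less[of t' u] by (intro bexI[of _ u]) (auto intro: prefix_order.trans)
qed

text \<open>Positivity is applied at a long extension \<open>t'\<close> of \<open>t\<close>. What is
  left above \<open>t'\<close> after removing the graphs of \<open>F\<close> is infinite, so it has
  a point outside the finite graph of \<open>t'\<close>; such a point lies on a proper extension of
  \<open>t'\<close>, at a position beyond \<open>t'\<close>.\<close>

lemma positive_tree_escapes:
  assumes T: "T \<in> positive_trees \<A>" and t: "t \<in> T" and F: "finite F" "F \<subseteq> \<A>"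
  shows "\<exists>u\<in>T. strict_prefix t u \<and> (\<exists>k<length u. n \<le> k \<and> length t \<le> k \<and> (\<forall>f\<in>F. u ! k \<noteq> f k))"
proof -
  have "is_tree T"
    using T unfolding positive_trees_def by blast
  then obtain t' where t': "t' \<in> T" "prefix t t'" "max n (length t) \<le> length t'"
    using tree_extension_of_length t by blast
  have "infinite ((\<Union>s\<in>subtree_at T t'. seq_graph s) - (\<Union>f\<in>F. fun_graph f))"
    using T t'(1) F unfolding positive_trees_def by blast
  moreover have "finite (seq_graph t')"
    unfolding seq_graph_def seq_dom_def by simp
  ultimately obtain x where x: "x \<in> (\<Union>s\<in>subtree_at T t'. seq_graph s) - (\<Union>f\<in>F. fun_graph f)"
      "x \<notin> seq_graph t'"
    by (meson finite_subset subsetI)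
  then obtain u k where u: "u \<in> subtree_at T t'" "x = (k, u ! k)" "k < length u"
    unfolding seq_graph_def seq_dom_def by auto
  \<comment> \<open>Otherwise the point \<open>x\<close> would already lie on the graph of
    \<open>t'\<close>.\<close>
  have "\<not> prefix u t'"
    using x(2) u prefix_nth[of u t' k] prefix_length_le[of u t']
    unfolding seq_graph_def seq_dom_def by force
  then have ut: "prefix t' u" "u \<in> T"
    using u(1) unfolding subtree_at_def by auto
  have k: "length t' \<le> k"
  proof (rule ccontr)
    assume "\<not> length t' \<le> k"
    then show False
      using x(2) u(2) prefix_nth[OF ut(1), of k] unfolding seq_graph_def seq_dom_def by force
  qed
  have "\<forall>f\<in>F. u ! k \<noteq> f k"
    using x(1) u(2) unfolding fun_graph_def by fastforce
  moreover have "strict_prefix t u"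
  proof -
    have "prefix t u" using t'(2) ut(1) prefix_order.trans by blast
    moreover have "length t < length u" using t'(3) k u(3) by linarith
    ultimately show ?thesis by (auto simp: strict_prefix_def)
  qed
  ultimately show ?thesis
    using ut(2) k t'(3) u(3) by (intro bexI[of _ u]) auto
qed

lemma dense_member:
  assumes "f \<in> \<A>"
  shows "dense_in (conditions \<A>) (cond_le \<A>) {(s, F) \<in> conditions \<A>. f \<in> F}"
  unfolding dense_in_def
proof (intro conjI ballI)
  fix p assume "p \<in> conditions \<A>"
  then obtain s F where p: "p = (s, F)" "(s, F) \<in> conditions \<A>"
    by (cases p) auto
  show "\<exists>d\<in>{(s, F) \<in> conditions \<A>. f \<in> F}. (d, p) \<in> cond_le \<A>"
    using p assms
    by (intro bexI[of _ "(s, insert f F)"]) (auto simp: cond_le_def conditions_def avoids_def)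
qed auto

text \<open>Meeting these sets makes the generic function total.\<close>

lemma dense_length:
  "dense_in (conditions \<A>) (cond_le \<A>) {(s, F) \<in> conditions \<A>. n \<le> length s}"
  unfolding dense_in_def
proof (intro conjI ballI)
  fix p assume "p \<in> conditions \<A>"
  then obtain s F where p: "p = (s, F)" "finite F" "F \<subseteq> \<A>"
    by (cases p) (auto simp: conditions_def)
  obtain s' where "prefix s s'" "length s' = max n (length s)" "avoids s' (length s) F"
    using extend_avoiding[OF p(2), of s "max n (length s)"] by auto
  then show "\<exists>d\<in>{(s, F) \<in> conditions \<A>. n \<le> length s}. (d, p) \<in> cond_le \<A>"
    using p by (intro bexI[of _ "(s', F)"]) (auto simp: cond_le_def conditions_def)
qed auto

text \<open>The tree offers a value outside \<open>F\<close> at some position \<open>k\<close>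
  beyond the stem. The gap up to \<open>k\<close> is filled while avoiding \<open>F\<close>, and
  then the value of the tree is copied, which breaks no promise.\<close>

lemma dense_diagonalization:
  assumes T: "T \<in> positive_trees \<A>" and t: "t \<in> T"
  shows "dense_in (conditions \<A>) (cond_le \<A>)
    {(s, F) \<in> conditions \<A>.
      \<exists>u\<in>T. strict_prefix t u \<and> (\<exists>k<length u. length t \<le> k \<and> k < length s \<and> u ! k = s ! k)}"
    (is "dense_in _ _ ?D")
  unfolding dense_in_def
proof (intro conjI ballI)
  fix p assume "p \<in> conditions \<A>"
  then obtain s F where p: "p = (s, F)" "finite F" "F \<subseteq> \<A>"
    by (cases p) (auto simp: conditions_def)
  obtain u k where u: "u \<in> T" "strict_prefix t u" "k < length u" "length s \<le> k" "length t \<le> k"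
      "\<forall>f\<in>F. u ! k \<noteq> f k"
    using positive_tree_escapes[OF T t p(2,3), of "length s"] by blast
  obtain s' where s': "prefix s s'" "length s' = k" "avoids s' (length s) F"
    using extend_avoiding[OF p(2) u(4)] by blast
  have "avoids (s' @ [u ! k]) (length s) F"
    using s' u(6) by (auto simp: avoids_def nth_append less_Suc_eq)
  then have "((s' @ [u ! k], F), p) \<in> cond_le \<A>"
    using p s' by (auto simp: cond_le_def conditions_def)
  moreover have "(s' @ [u ! k], F) \<in> ?D"
    using p u s'(2) by (auto simp: conditions_def intro!: bexI[of _ u] exI[of _ k])
  ultimately show "\<exists>d\<in>?D. (d, p) \<in> cond_le \<A>"
    by blast
qed auto

text \<open>One dense set per member of \<open>\<A>\<close>, one per length and one per node of each
  tree are fewer than continuum many. A filter meeting them all yields \<open>g\<close> as the union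
  of its stems.\<close>

lemma MA_diagonalizing_function:
  assumes MA: MA_sigma_centered and small: "|\<A>| <o continuum"
    and T: "\<And>n::nat. T n \<in> positive_trees \<A>"
  shows "\<exists>g. (\<forall>f\<in>\<A>. g \<noteq>\<^sup>* f) \<and> (\<forall>n. densely_diagonalizes g (T n))"
proof -
  define mem where "mem f = {(s, F) \<in> conditions \<A>. f \<in> F}" for f
  define len where "len n = {(s :: nat list, F) \<in> conditions \<A>. n \<le> length s}" for n
  define diag where "diag = (\<lambda>(n, t). {(s, F) \<in> conditions \<A>. \<exists>u\<in>T n. strict_prefix t u \<and>
      (\<exists>k<length u. length t \<le> k \<and> k < length s \<and> u ! k = s ! k)})"
  define \<D> where "\<D> = mem ` \<A> \<union> (range len \<union> diag ` {(n, t). t \<in> T n})"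
  have "|\<D>| <o continuum"
    unfolding \<D>_def
    by (intro Un_ordLess_continuum image_ordLess_continuum countable_ordLess_continuum small) auto
  moreover have "\<forall>D\<in>\<D>. dense_in (conditions \<A>) (cond_le \<A>) D"
    unfolding \<D>_def mem_def len_def diag_def
    using dense_member dense_length dense_diagonalization T by auto
  moreover have "MA_for (conditions \<A>) (cond_le \<A>)"
  proof (rule MA_for_transfer[OF MA inj_encode_condition _ partial_order_cond_le sigma_centered_conditions])
    show "conditions \<A> \<noteq> {}"
      unfolding conditions_def by blast
  qed
  ultimately obtain G where G: "filter_in (conditions \<A>) (cond_le \<A>) G" "\<forall>D\<in>\<D>. G \<inter> D \<noteq> {}"
    unfolding MA_for_def by blast
  have common: "\<exists>s'' F''. (s'', F'') \<in> G \<and> ((s'', F''), (s, F)) \<in> cond_le \<A> \<and> ((s'', F''), (s', F')) \<in> cond_le \<A>"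
    if "(s, F) \<in> G" "(s', F') \<in> G" for s F s' F'
    using G(1) that unfolding filter_in_def by (metis surj_pair)
  have agree: "s ! k = s' ! k" if "(s, F) \<in> G" "(s', F') \<in> G" "k < length s" "k < length s'" for s F s' F' k
  proof -
    note G_mem = that(1,2) and len = that(3,4)
    obtain s'' where "prefix s s''" "prefix s' s''"
      using common[OF G_mem] unfolding cond_le_def by auto
    then show ?thesis
      using prefix_nth[of s s'' k] prefix_nth[of s' s'' k] len by simp
  qed
  have long: "\<exists>s F. (s, F) \<in> G \<and> k < length s" for k
  proof -
    have "len (Suc k) \<in> \<D>"
      unfolding \<D>_def by blast
    then have "G \<inter> len (Suc k) \<noteq> {}"
      using G(2) by blast
    then show ?thesis
      unfolding len_def by auto
  qed
  \<comment> \<open>By \<open>long\<close> a suitable stem exists, and by \<open>agree\<close> the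
    value does not depend on the stem chosen.\<close>
  define g where "g k = (SOME v. \<exists>s F. (s, F) \<in> G \<and> k < length s \<and> v = s ! k)" for k
  have g: "g k = s ! k" if s: "(s, F) \<in> G" "k < length s" for s F k
  proof -
    have "\<exists>v s F. (s, F) \<in> G \<and> k < length s \<and> v = s ! k"
      using s by blast
    from someI_ex[OF this] obtain s' F' where "(s', F') \<in> G" "k < length s'" "g k = s' ! k"
      unfolding g_def by blast
    then show ?thesis
      using agree[OF _ s(1) _ s(2)] by simp
  qed
  have "g \<noteq>\<^sup>* f" if "f \<in> \<A>" for f
  proof -
    have "G \<inter> mem f \<noteq> {}"
      using G(2) that unfolding \<D>_def by blast
    then obtain s F where sF: "(s, F) \<in> G" "f \<in> F"
      unfolding mem_def by auto
    \<comment> \<open>A stem reaching \<open>n\<close> is amalgamated in \<open>G\<close> with the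
      condition that promised to avoid \<open>f\<close>; entry \<open>n\<close> of the common
      extension obeys the promise and equals \<open>g n\<close>.\<close>
    have "g n \<noteq> f n" if n: "n > length s" for n
    proof -
      obtain s' F' where s': "(s', F') \<in> G" "n < length s'"
        using long by blast
      obtain s'' F'' where s'': "(s'', F'') \<in> G" "((s'', F''), (s, F)) \<in> cond_le \<A>"
          "((s'', F''), (s', F')) \<in> cond_le \<A>"
        using common[OF sF(1) s'(1)] by blast
      have "n < length s''"
        using s''(3) s'(2) prefix_length_le[of s' s''] unfolding cond_le_def by auto
      moreover have "avoids s'' (length s) F"
        using s''(2) unfolding cond_le_def by auto
      ultimately show ?thesis
        using g[OF s''(1)] n sF(2) unfolding avoids_def by auto
    qed
    then show ?thesis
      unfolding ev_neq_def by blast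
  qed
  moreover have "densely_diagonalizes g (T n)" for n
    unfolding densely_diagonalizes_def
  proof
    fix t assume "t \<in> T n"
    then have "G \<inter> diag (n, t) \<noteq> {}"
      using G(2) unfolding \<D>_def by blast
    then obtain s F u k where "(s, F) \<in> G" "u \<in> T n" "strict_prefix t u" "k < length u"
        "length t \<le> k" "k < length s" "u ! k = s ! k"
      unfolding diag_def by auto
    then show "\<exists>s\<in>T n. strict_prefix t s \<and> (\<exists>k\<in>seq_dom s - seq_dom t. s ! k = g k)"
      using g by (intro bexI[of _ u]) (auto simp: seq_dom_def intro!: bexI[of _ k])
  qed
  ultimately show ?thesis by blast
qed

section \<open>Tight extensions by transfinite recursion\<close>

lemma positive_trees_antimono: "\<A> \<subseteq> \<B> \<Longrightarrow> positive_trees \<B> \<subseteq> positive_trees \<A>"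
  unfolding positive_trees_def by blast

text \<open>Supplies a harmless substitute for the non-positive entries of a sequence.\<close>

lemma empty_tree_positive: "{} \<in> positive_trees \<A>"
  unfolding positive_trees_def is_tree_def by blast

lemma ev_neq_sym: "f \<noteq>\<^sup>* g \<Longrightarrow> g \<noteq>\<^sup>* f"
  unfolding ev_neq_def by metis

lemma MA_tight_extension:
  assumes MA: MA_sigma_centered and ed: "ev_different_family \<E>\<^sub>0" and small: "|\<E>\<^sub>0| <o continuum"
  shows "\<exists>\<E>. \<E>\<^sub>0 \<subseteq> \<E> \<and> ev_different_family \<E> \<and> tight \<E>"
proof -
  \<comment> \<open>The sequences index the recursion themselves. Taking a cardinal as the
    well-order keeps each proper initial segment below the continuum.\<close>
  define r where "r = |UNIV :: (nat \<Rightarrow> nat list set) set|"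
  have Cr: "Card_order r"
    unfolding r_def by (rule card_of_Card_order)
  then have wo: "Well_order r"
    by (simp add: card_order_on_def)
  have Fr: "Field r = UNIV"
    unfolding r_def by (rule Field_card_of)
  have wf: "wf (r - Id)"
    using wo by (simp add: well_order_on_def)
  have linear: "(S, S') \<in> r - Id \<or> (S', S) \<in> r - Id" if "S \<noteq> S'" for S S'
    using wo Fr that by (auto simp: well_order_on_def linear_order_on_def total_on_def)
  define earlier where "earlier g S = \<E>\<^sub>0 \<union> g ` underS r S" for g :: "_ \<Rightarrow> nat \<Rightarrow> nat" and S
  \<comment> \<open>Positivity refers to the family built so far, so diagonalization is demanded
    only for those entries of \<open>S\<close> that are positive at stage \<open>S\<close>.\<close>
  have "\<exists>g. \<forall>S. (\<forall>f\<in>earlier g S. g S \<noteq>\<^sup>* f) \<and>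
      (\<forall>n. S n \<in> positive_trees (earlier g S) \<longrightarrow> densely_diagonalizes (g S) (S n))"
  proof (rule dependent_wf_choice[OF wf])
    \<comment> \<open>Well-founded choice requires that the condition at stage \<open>S\<close>
      depend only on the values of \<open>g\<close> strictly before \<open>S\<close>.\<close>
    fix g g' :: "(nat \<Rightarrow> nat list set) \<Rightarrow> nat \<Rightarrow> nat" and S h
    assume "\<And>S'. (S', S) \<in> r - Id \<Longrightarrow> g S' = g' S'"
    then have "earlier g S = earlier g' S"
      unfolding earlier_def underS_def by auto
    then show "((\<forall>f\<in>earlier g S. h \<noteq>\<^sup>* f) \<and>
        (\<forall>n. S n \<in> positive_trees (earlier g S) \<longrightarrow> densely_diagonalizes h (S n))) =
      ((\<forall>f\<in>earlier g' S. h \<noteq>\<^sup>* f) \<and>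
        (\<forall>n. S n \<in> positive_trees (earlier g' S) \<longrightarrow> densely_diagonalizes h (S n)))"
      by simp
  next
    fix S and g :: "(nat \<Rightarrow> nat list set) \<Rightarrow> nat \<Rightarrow> nat"
    define T where "T n = (if S n \<in> positive_trees (earlier g S) then S n else {})" for n
    have "|underS r S| <o continuum"
      using card_of_underS[OF Cr] Fr tree_sequences_ordLeq_continuum ordLess_ordLeq_trans
      unfolding r_def by blast
    then have "|earlier g S| <o continuum"
      unfolding earlier_def by (intro Un_ordLess_continuum image_ordLess_continuum small)
    moreover have "T n \<in> positive_trees (earlier g S)" for n
      unfolding T_def by (simp add: empty_tree_positive)
    ultimately obtain h where h: "\<forall>f\<in>earlier g S. h \<noteq>\<^sup>* f" "\<forall>n. densely_diagonalizes h (T n)"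
      using MA_diagonalizing_function[OF MA] by blast
    have "densely_diagonalizes h (S n)" if "S n \<in> positive_trees (earlier g S)" for n
      using h(2)[rule_format, of n] that by (simp add: T_def)
    then show "\<exists>h. (\<forall>f\<in>earlier g S. h \<noteq>\<^sup>* f) \<and>
        (\<forall>n. S n \<in> positive_trees (earlier g S) \<longrightarrow> densely_diagonalizes h (S n))"
      using h(1) by blast
  qed
  then obtain g where new: "\<And>S f. f \<in> earlier g S \<Longrightarrow> g S \<noteq>\<^sup>* f"
    and diag: "\<And>S n. S n \<in> positive_trees (earlier g S) \<Longrightarrow> densely_diagonalizes (g S) (S n)"
    by blast
  define \<E> where "\<E> = \<E>\<^sub>0 \<union> range g"
  have g_g: "g S \<noteq>\<^sup>* g S'" if "g S \<noteq> g S'" for S S'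
  proof -
    \<comment> \<open>Different values have different indices, so one of the two stages precedes the
      other.\<close>
    have "g S' \<in> earlier g S \<or> g S \<in> earlier g S'"
      using that linear[of S S'] unfolding earlier_def underS_def by auto
    then show ?thesis
      using new ev_neq_sym by blast
  qed
  have g_E0: "g S \<noteq>\<^sup>* f" if "f \<in> \<E>\<^sub>0" for S f
    using new that unfolding earlier_def by blast
  have "ev_different_family \<E>"
    using ed g_g g_E0 ev_neq_sym unfolding ev_different_family_def \<E>_def by blast
  moreover have "tight \<E>"
    unfolding tight_def
  proof (intro allI impI)
    fix S :: "nat \<Rightarrow> nat list set"
    assume "\<forall>n. S n \<in> positive_trees \<E>"
    moreover have "earlier g S \<subseteq> \<E>"
      unfolding earlier_def \<E>_def by blast
    \<comment> \<open>The witness is the function added at the stage indexed by \<open>S\<close>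
      itself.\<close>
    ultimately have "\<forall>n. densely_diagonalizes (g S) (S n)"
      using diag positive_trees_antimono by blast
    then show "\<exists>g\<in>\<E>. \<forall>n. densely_diagonalizes g (S n)"
      unfolding \<E>_def by blast
  qed
  ultimately show ?thesis
    unfolding \<E>_def by blast
qed

theorem theorem2p6:
  shows "(MA_sigma_centered \<longrightarrow>
            (\<forall>\<E>\<^sub>0. ev_different_family \<E>\<^sub>0 \<and> |\<E>\<^sub>0| <o continuum \<longrightarrow>
               (\<exists>\<E>. \<E>\<^sub>0 \<subseteq> \<E> \<and> ev_different_family \<E> \<and> tight \<E>))) \<and>
         (CH \<longrightarrow> (\<exists>\<E>. ev_different_family \<E> \<and> tight \<E>))"
proof (intro conjI impI allI)
  fix \<E>\<^sub>0
  assume "MA_sigma_centered" "ev_different_family \<E>\<^sub>0 \<and> |\<E>\<^sub>0| <o continuum"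
  then show "\<exists>\<E>. \<E>\<^sub>0 \<subseteq> \<E> \<and> ev_different_family \<E> \<and> tight \<E>"
    using MA_tight_extension by blast
next
  assume CH
  moreover have "ev_different_family {}"
    by (simp add: ev_different_family_def)
  ultimately show "\<exists>\<E>. ev_different_family \<E> \<and> tight \<E>"
    \<comment> \<open>Under \<open>CH\<close> the empty family is the one extended.\<close>
    using MA_tight_extension[of "{}"] CH_imp_MA_sigma_centered countable_ordLess_continuum[of "{}"]
    by auto
qed

end
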